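(* Let $D_6=(V,A)$ be the digraph with vertex set $V=\{v_1,v_2,v_3,v_4,v_5,v_6,v_7\}$ and arc set $A=\{(v_2,v_1),(v_2,v_3),(v_4,v_1),(v_4,v_3),(v_5,v_1),(v_5,v_2),(v_5,v_3),(v_5,v_4),(v_6,v_1),(v_6,v_2),(v_6,v_3),(v_6,v_4),(v_7,v_5),(v_7,v_6)\}$ (where $v_1,\dots,v_7$ represent holomorphic, CR, anti-invariant, slant, semi-slant, hemi-slant and bi-slant submanifolds of almost Hermitian manifolds, respectively). Then: (i) $D_6$ is a three-partite digraph; (ii) the maximum size of a matching of $D_6$ is $3$; (iii) the independence number of $D_6$ is $3$; (iv) the chromatic number of $D_6$ is $3$; (v) $D_6$ contains a directed spanning tree; (vi) the domination number of $D_6$ is $2$.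
   Context: An arc $(u,v)$ goes from $u$ to $v$. The geometric meaning of the vertices plays no role in the statement; the digraph is the explicit one given. Definitions for a digraph $D=(V,A)$: - $D$ is $p$-partite if $V$ can be partitioned into $p$ nonempty sets such that no arc joins two vertices of the same set. - A matching is a set of arcs, none a loop, no two of which share an end-vertex. - A set of vertices is independent if there are no arcs between its members. The independence number is the maximum size of an independent set. The chromatic number is the minimum number of sets in a partition of $V$ into independent sets. - A directed spanning tree of $D$ with root $r\in V$ is a subdigraph $T$ of $D$ with $V(T)=V$ whose underlying undirected graph is a tree and in which there is a unique directed path from $r$ to each $v\in V\setminus\{r\}$. "$D$ contains a directed spanning tree" means one exists for some root $r$. - A dominating set is a set $S\subseteq V$ such that for every $v\in V\setminus S$ there is $u\in S$ with $(u,v)\in A$. The domination number is the minimum cardinality of a dominating set. *)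

theory Defs
  imports "Graph_Theory.Digraph_Component" "HOL-Library.Disjoint_Sets"
begin

definition partite :: "nat \<Rightarrow> ('a,'b) pre_digraph \<Rightarrow> bool" where
  "partite p G \<longleftrightarrow> (\<exists>P. partition_on (verts G) P \<and> finite P \<and> card P = p \<and>
     (\<forall>X\<in>P. \<not> (\<exists>e\<in>arcs G. tail G e \<in> X \<and> head G e \<in> X)))"

definition matching :: "('a,'b) pre_digraph \<Rightarrow> 'b set \<Rightarrow> bool" where
  "matching G M \<longleftrightarrow> M \<subseteq> arcs G \<and> (\<forall>e\<in>M. tail G e \<noteq> head G e) \<and>
     (\<forall>e\<in>M. \<forall>f\<in>M. e \<noteq> f \<longrightarrow> {tail G e, head G e} \<inter> {tail G f, head G f} = {})"

text \<open>The numerical invariants below are meant for finite digraphs, where the sets under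
  \<open>Max\<close> and \<open>Min\<close> are finite; for the chromatic number there must moreover be no loops.\<close>

definition matching_number :: "('a,'b) pre_digraph \<Rightarrow> nat" where
  "matching_number G = Max (card ` {M. matching G M})"

definition independent :: "('a,'b) pre_digraph \<Rightarrow> 'a set \<Rightarrow> bool" where
  "independent G S \<longleftrightarrow> S \<subseteq> verts G \<and> (\<forall>u\<in>S. \<forall>v\<in>S. \<not> u \<rightarrow>\<^bsub>G\<^esub> v)"

definition independence_number :: "('a,'b) pre_digraph \<Rightarrow> nat" where
  "independence_number G = Max (card ` {S. independent G S})"

definition chromatic_number :: "('a,'b) pre_digraph \<Rightarrow> nat" where
  "chromatic_number G =
     Min (card ` {P. partition_on (verts G) P \<and> (\<forall>S\<in>P. independent G S)})"

definition dominating :: "('a,'b) pre_digraph \<Rightarrow> 'a set \<Rightarrow> bool" where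
  "dominating G S \<longleftrightarrow> S \<subseteq> verts G \<and> (\<forall>v\<in>verts G - S. \<exists>u\<in>S. u \<rightarrow>\<^bsub>G\<^esub> v)"

definition domination_number :: "('a,'b) pre_digraph \<Rightarrow> nat" where
  "domination_number G = Min (card ` {S. dominating G S})"

text \<open>The library predicates \<open>forest\<close> and \<open>tree\<close> only exclude directed cycles, so they do not say
  that the underlying undirected graph is a forest or a tree. To express the latter, every arc
  \<open>e\<close> is replaced by its two traversals \<open>(e, False)\<close> (forwards) and \<open>(e, True)\<close> (backwards). A cycle
  of the underlying undirected (multi)graph is then a cycle of traversals that uses no arc
  twice; a loop or a pair of antiparallel arcs counts as such a cycle.\<close>

definition traversals :: "('a,'b) pre_digraph \<Rightarrow> ('a, 'b \<times> bool) pre_digraph" where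
  "traversals G = \<lparr> verts = verts G, arcs = arcs G \<times> UNIV,
     tail = (\<lambda>(e, back). if back then head G e else tail G e),
     head = (\<lambda>(e, back). if back then tail G e else head G e) \<rparr>"

definition underlying_tree :: "('a,'b) pre_digraph \<Rightarrow> bool" where
  "underlying_tree G \<longleftrightarrow> connected G \<and>
     \<not> (\<exists>p. pre_digraph.cycle (traversals G) p \<and> distinct (map fst p))"

definition directed_spanning_tree ::
    "('a,'b) pre_digraph \<Rightarrow> ('a,'b) pre_digraph \<Rightarrow> 'a \<Rightarrow> bool" where
  "directed_spanning_tree T G r \<longleftrightarrow> spanning T G \<and> r \<in> verts G \<and> underlying_tree T \<and>
     (\<forall>v\<in>verts G - {r}. \<exists>!p. pre_digraph.apath T r p v)"

datatype vertex = v1 | v2 | v3 | v4 | v5 | v6 | v7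

definition D6 :: "(vertex, vertex \<times> vertex) pre_digraph" where
  "D6 = \<lparr> verts = {v1, v2, v3, v4, v5, v6, v7},
     arcs = {(v2,v1), (v2,v3), (v4,v1), (v4,v3),
             (v5,v1), (v5,v2), (v5,v3), (v5,v4),
             (v6,v1), (v6,v2), (v6,v3), (v6,v4),
             (v7,v5), (v7,v6)},
     tail = fst, head = snd \<rparr>"

lemma digraph_D6: "digraph D6"
  by unfold_locales (auto simp: D6_def arc_to_ends_def)

end

theory Submission
  imports Defs
begin

text \<open>The tripartition \<open>{v1, v3, v7}\<close>, \<open>{v2, v4}\<close>, \<open>{v5, v6}\<close> is optimal because
  \<open>v1, v2, v5\<close> are pairwise adjacent, and every independent set lies in one of
  \<open>{v1, v3, v7}\<close>, \<open>{v2, v4, v7}\<close>, \<open>{v5, v6}\<close>. A matching of size 4 would need eight vertices.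
  The source \<open>v7\<close> belongs to every dominating set but does not dominate \<open>v1\<close>. The arcs from \<open>v7\<close>
  to \<open>v5, v6\<close> and from \<open>v5\<close> to \<open>v1, v2, v3, v4\<close> form a directed spanning tree.\<close>

section \<open>Digraphs whose arcs have distinct heads and increase a depth\<close>

text \<open>An easily checked certificate for a branching: distinct heads force an undirected cycle
  to be a directed one, and the increasing depth excludes those.\<close>

locale levelled_digraph = wf_digraph G for G +
  fixes depth :: "'a \<Rightarrow> nat"
  assumes inj_head: "inj_on (head G) (arcs G)"
    and depth_less: "e \<in> arcs G \<Longrightarrow> depth (tail G e) < depth (head G e)"
begin

text \<open>Every arc raises the depth by at least one. For \<open>u = v\<close> only the empty walk
  remains.\<close>

lemma depth_awalk: "awalk u p v \<Longrightarrow> depth u + length p \<le> depth v"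
proof (induction p arbitrary: u)
  case (Cons e p)
  from Cons.prems have "e \<in> arcs G" "u = tail G e" "awalk (head G e) p v"
    by (auto simp: awalk_Cons_iff)
  with Cons.IH[of "head G e"] depth_less[of e] show ?case by simp
qed (simp add: awalk_Nil_iff)

text \<open>The last arcs of two nonempty walks to \<open>v\<close> both have head \<open>v\<close>,
  hence coincide, and induction strips them off. If one walk is empty, the other is closed and the
  depth forces it to be empty too.\<close>

lemma awalk_unique:
  assumes "awalk u p v" "awalk u q v"
  shows "p = q"
  using assms
proof (induction p arbitrary: v q rule: rev_induct)
  case Nil
  then have "depth u + length q \<le> depth u"
    using depth_awalk[of u q v] by (simp add: awalk_Nil_iff)
  then show ?case by simp
next
  case (snoc e p)
  from snoc.prems(1) have e: "e \<in> arcs G" "head G e = v" "awalk u p (tail G e)"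
    by (auto simp: awalk_simps)
  show ?case
  proof (cases q rule: rev_cases)
    case Nil
    with snoc.prems depth_awalk[OF snoc.prems(1)] show ?thesis
      by (auto simp: awalk_Nil_iff)
  next
    case (snoc q' f)
    with snoc.prems(2) have f: "f \<in> arcs G" "head G f = v" "awalk u q' (tail G f)"
      by (auto simp: awalk_simps)
    with e have "e = f" using inj_head by (auto dest: inj_onD)
    with snoc.IH[OF e(3)] f(3) snoc show ?thesis by simp
  qed
qed

text \<open>After a forward traversal the only arc into the vertex reached is used up, so the
  walk can only continue forwards.\<close>

lemma forward_trail:
  assumes "pre_digraph.cas (traversals G) u ((e, False) # p) v"
    and "fst ` set ((e, False) # p) \<subseteq> arcs G"
    and "distinct (map fst ((e, False) # p))"
  shows "v \<in> head G ` fst ` set ((e, False) # p) \<and> depth u < depth v"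
  using assms
proof (induction p arbitrary: u e)
  case Nil
  then show ?case
    using depth_less by (auto simp: pre_digraph.cas.simps traversals_def)
next
  case (Cons x p)
  obtain f b where x: "x = (f, b)" by (cases x)
  from Cons.prems x have ef: "e \<in> arcs G" "f \<in> arcs G" "e \<noteq> f" "u = tail G e"
    by (auto simp: pre_digraph.cas.simps traversals_def)
  have b: "\<not> b"
  proof
    assume b
    with Cons.prems x have "head G f = head G e"
      by (simp add: pre_digraph.cas.simps traversals_def)
    with ef inj_head show False by (auto dest: inj_onD)
  qed
  with Cons.prems x have "pre_digraph.cas (traversals G) (head G e) ((f, False) # p) v"
    by (simp add: pre_digraph.cas.simps traversals_def)
  from Cons.IH[OF this] Cons.prems x b ef depth_less[of e] show ?case by auto
qed

text \<open>Only \<open>f\<close> enters \<open>head G f\<close>, so a trail that avoids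
  \<open>f\<close> cannot arrive there by a forward traversal. As forward traversals are followed
  only by forward ones, all its steps go backwards and the depth falls.\<close>

lemma backward_trail:
  assumes "pre_digraph.cas (traversals G) u p (head G f)"
    and "fst ` set p \<subseteq> arcs G" "distinct (map fst p)" "f \<in> arcs G" "f \<notin> fst ` set p"
  shows "depth (head G f) \<le> depth u"
  using assms
proof (induction p arbitrary: u)
  case Nil
  then show ?case by (simp add: pre_digraph.cas.simps)
next
  case (Cons x p)
  obtain e b where x: "x = (e, b)" by (cases x)
  have b: b
  proof (rule ccontr)
    assume "\<not> b"
    with forward_trail[of u e p "head G f"] Cons.prems x
    have "head G f \<in> head G ` fst ` set (x # p)" by simp
    then obtain g where g: "g \<in> fst ` set (x # p)" "head G f = head G g" by blast
    with Cons.prems(2) have "g \<in> arcs G" by blast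
    with g Cons.prems(4) inj_head have "f = g" by (auto dest: inj_onD)
    with g Cons.prems(5) show False by blast
  qed
  with Cons.prems x have "pre_digraph.cas (traversals G) (tail G e) p (head G f)"
    and "u = head G e" "e \<in> arcs G"
    by (simp_all add: pre_digraph.cas.simps traversals_def)
  with Cons.IH[of "tail G e"] Cons.prems depth_less[of e] show ?case by simp
qed

text \<open>A cycle that starts forwards would end at a greater depth than it began. If it starts by
  traversing \<open>e\<close> backwards, the rest leads from \<open>tail G e\<close> to
  \<open>head G e\<close> without using \<open>e\<close>, against the growth of the depth along
  \<open>e\<close>.\<close>

lemma no_underlying_cycle:
  assumes "pre_digraph.cycle (traversals G) p" "distinct (map fst p)"
  shows False
proof -
  from assms(1) obtain u where p: "p \<noteq> []" "pre_digraph.cas (traversals G) u p u"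
    "set p \<subseteq> arcs (traversals G)"
    by (auto simp: pre_digraph.cycle_def pre_digraph.awalk_def)
  then have arcs: "fst ` set p \<subseteq> arcs G" by (auto simp: traversals_def)
  obtain e b q where q: "p = (e, b) # q" using p(1) by (metis list.exhaust surj_pair)
  show False
  proof (cases b)
    case False
    with forward_trail[of u e q u] p arcs assms(2) q show False by simp
  next
    case True
    with p(2) q have "u = head G e" "pre_digraph.cas (traversals G) (tail G e) q (head G e)"
      by (simp_all add: pre_digraph.cas.simps traversals_def)
    with backward_trail[of "tail G e" q e] arcs assms(2) q depth_less[of e]
    show False by auto
  qed
qed

lemma underlying_tree_rooted:
  assumes "r \<in> verts G" and reach: "\<And>v. v \<in> verts G \<Longrightarrow> r \<rightarrow>\<^sup>*\<^bsub>G\<^esub> v"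
  shows "underlying_tree G"
proof -
  interpret S: pair_wf_digraph "mk_symmetric G" ..
  \<comment> \<open>Any two vertices are joined through the root, going back from \<open>u\<close>
    to \<open>r\<close> by symmetry.\<close>
  have "u \<rightarrow>\<^sup>*\<^bsub>mk_symmetric G\<^esub> v" if "u \<in> verts G" "v \<in> verts G" for u v
  proof -
    have "r \<rightarrow>\<^sup>*\<^bsub>mk_symmetric G\<^esub> u" "r \<rightarrow>\<^sup>*\<^bsub>mk_symmetric G\<^esub> v"
      using that reach reachable_mk_symmetricI by blast+
    then show ?thesis
      using symmetric_reachable[OF symmetric_mk_symmetric] by (metis S.reachable_trans)
  qed
  then have "connected G"
    using assms(1) by (auto simp: connected_def)
  then show ?thesis
    using no_underlying_cycle by (auto simp: underlying_tree_def)
qed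

lemma directed_spanning_tree_rooted:
  assumes "spanning G H" "r \<in> verts G" "\<And>v. v \<in> verts G \<Longrightarrow> r \<rightarrow>\<^sup>*\<^bsub>G\<^esub> v"
  shows "directed_spanning_tree G H r"
proof -
  \<comment> \<open>Reachability yields a path; uniqueness holds even among all walks.\<close>
  have "\<exists>!p. apath r p v" if "v \<in> verts G" for v
    using assms(3)[OF that] awalk_unique by (auto simp: reachable_apath apath_def)
  then show ?thesis
    using assms underlying_tree_rooted[of r]
    by (auto simp: directed_spanning_tree_def spanning_def)
qed

end

section \<open>General bounds for matchings and colourings\<close>

lemma (in wf_digraph) card_matching_le:
  assumes "matching G M" "finite (verts G)"
  shows "2 * card M \<le> card (verts G)"
proof -
  let ?ends = "\<lambda>e. {tail G e, head G e}"
  have sub: "(\<Union>e\<in>M. ?ends e) \<subseteq> verts G"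
    using assms(1) by (auto simp: matching_def)
  have two: "card (?ends e) = 2" if "e \<in> M" for e
    using assms(1) that by (auto simp: matching_def)
  have disj: "\<forall>e\<in>M. \<forall>f\<in>M. e \<noteq> f \<longrightarrow> ?ends e \<inter> ?ends f = {}"
    using assms(1) unfolding matching_def by blast
  \<comment> \<open>The arc set may be infinite, so finiteness of \<open>M\<close> is drawn from
    that of the vertex set.\<close>
  have "inj_on ?ends M"
    using disj by (intro inj_onI) blast
  moreover have "?ends ` M \<subseteq> Pow (verts G)" using sub by blast
  ultimately have "finite M"
    using assms(2) by (meson finite_Pow_iff inj_on_finite)
  then have "card (\<Union>e\<in>M. ?ends e) = 2 * card M"
    using disj two by (subst card_UN_disjoint) auto
  then show ?thesis
    using card_mono[OF assms(2) sub] by simp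
qed

text \<open>Sending each vertex of \<open>K\<close> to a class containing it is injective, since two
  adjacent vertices cannot share an independent class.\<close>

lemma card_clique_le_independent_partition:
  assumes "partition_on (verts G) P" "finite P" "\<forall>S\<in>P. independent G S" "K \<subseteq> verts G"
    and clique: "\<And>u v. u \<in> K \<Longrightarrow> v \<in> K \<Longrightarrow> u \<noteq> v \<Longrightarrow> u \<rightarrow>\<^bsub>G\<^esub> v \<or> v \<rightarrow>\<^bsub>G\<^esub> u"
  shows "card K \<le> card P"
proof -
  have "\<forall>v\<in>K. \<exists>S\<in>P. v \<in> S"
    using assms(1,4) by (auto simp: partition_on_def)
  then obtain f where f: "\<And>v. v \<in> K \<Longrightarrow> f v \<in> P \<and> v \<in> f v" by metis
  have "inj_on f K"
    using f clique assms(3) by (intro inj_onI) (metis independent_def)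
  then show ?thesis
    using f assms(2) by (intro card_inj_on_le[of f]) auto
qed

lemma Max_card_eqI:
  assumes "finite {S. P S}" "\<And>S. P S \<Longrightarrow> card S \<le> n" "P S" "card S = n"
  shows "Max (card ` {S. P S}) = n"
  using assms by (intro Max_eqI) auto

lemma Min_card_eqI:
  assumes "finite {S. P S}" "\<And>S. P S \<Longrightarrow> n \<le> card S" "P S" "card S = n"
  shows "Min (card ` {S. P S}) = n"
  using assms by (intro Min_eqI) auto

section \<open>The digraph \<open>D6\<close> and its tripartition\<close>

lemma verts_D6: "verts D6 = {v1, v2, v3, v4, v5, v6, v7}"
  by (simp add: D6_def)

lemma finite_verts_D6: "finite (verts D6)"
  by (simp add: verts_D6)

lemma adj_D6: "u \<rightarrow>\<^bsub>D6\<^esub> v \<longleftrightarrow> (u, v) \<in> arcs D6"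
  by (auto simp: arcs_ends_def arc_to_ends_def D6_def)

lemma arcs_D6: "arcs D6 =
  {(v2,v1), (v2,v3), (v4,v1), (v4,v3), (v5,v1), (v5,v2), (v5,v3), (v5,v4),
   (v6,v1), (v6,v2), (v6,v3), (v6,v4), (v7,v5), (v7,v6)}"
  by (simp add: D6_def)

text \<open>A witness used three times: for three-partiteness, for the chromatic number, and,
  through its class \<open>{v1, v3, v7}\<close>, for the independence number.\<close>

abbreviation "colouring_D6 \<equiv> {{v1, v3, v7}, {v2, v4}, {v5, v6}}"

lemma partition_colouring_D6: "partition_on (verts D6) colouring_D6"
  by (auto simp: partition_on_def disjoint_def verts_D6)

lemma card_colouring_D6: "card colouring_D6 = 3"
proof -
  have "{v1, v3, v7} \<noteq> {v2, v4}" "{v1, v3, v7} \<noteq> {v5, v6}" "{v2, v4} \<noteq> {v5, v6}" by blast+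
  then show ?thesis by simp
qed

lemma independent_colouring_D6: "\<forall>S\<in>colouring_D6. independent D6 S"
  by (simp add: independent_def adj_D6 arcs_D6 verts_D6)

lemma partite_D6: "partite 3 D6"
proof -
  have "\<forall>X\<in>colouring_D6. \<not> (\<exists>e\<in>arcs D6. tail D6 e \<in> X \<and> head D6 e \<in> X)"
    by (simp add: D6_def)
  then show ?thesis
    unfolding partite_def using partition_colouring_D6 card_colouring_D6 by blast
qed

section \<open>Numerical invariants of \<open>D6\<close>\<close>

lemma matching_number_D6: "matching_number D6 = 3"
  unfolding matching_number_def
proof (rule Max_card_eqI)
  interpret digraph D6 by (rule digraph_D6)
  show "finite {M. matching D6 M}"
    by (rule finite_subset[of _ "Pow (arcs D6)"]) (auto simp: matching_def)
  show "card M \<le> 3" if "matching D6 M" for M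
    using card_matching_le[OF that finite_verts_D6] by (simp add: verts_D6)
  \<comment> \<open>Only \<open>v6\<close> stays uncovered.\<close>
  show "matching D6 {(v2,v1), (v4,v3), (v7,v5)}"
    by (simp add: matching_def D6_def)
qed simp

text \<open>Both \<open>v5\<close> and \<open>v6\<close> are adjacent to all of the other five
  vertices, so a set meeting \<open>{v5, v6}\<close> stays inside it. Otherwise a set meeting
  \<open>{v1, v3}\<close> misses \<open>v2\<close> and \<open>v4\<close>, which are adjacent to
  both.\<close>

lemma independent_D6_cases:
  assumes "independent D6 S"
  shows "S \<subseteq> {v1, v3, v7} \<or> S \<subseteq> {v2, v4, v7} \<or> S \<subseteq> {v5, v6}"
proof -
  have "\<forall>(u, v)\<in>arcs D6. u \<notin> S \<or> v \<notin> S"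
    using assms by (auto simp: independent_def adj_D6)
  then have non_adj: "x \<in> {v5, v6} \<Longrightarrow> y \<in> {v1, v2, v3, v4, v7} \<Longrightarrow> x \<notin> S \<or> y \<notin> S"
    "x \<in> {v1, v3} \<Longrightarrow> y \<in> {v2, v4} \<Longrightarrow> x \<notin> S \<or> y \<notin> S" for x y
    unfolding arcs_D6 by auto
  have "x \<in> {v5, v6}" if "x \<in> S" "y \<in> S" "y \<in> {v5, v6}" for x y
    using that non_adj(1)[of y x] by (cases x) simp_all
  moreover have "x \<in> {v5, v6} \<union> {v1, v3, v7}" if "x \<in> S" "y \<in> S" "y \<in> {v1, v3}" for x y
    using that non_adj(2)[of y x] by (cases x) simp_all
  moreover have "x \<in> {v5, v6} \<union> {v1, v3} \<union> {v2, v4, v7}" for x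
    by (cases x) simp_all
  ultimately show ?thesis by blast
qed

lemma independence_number_D6: "independence_number D6 = 3"
  unfolding independence_number_def
proof (rule Max_card_eqI)
  show "finite {S. independent D6 S}"
    by (rule finite_subset[of _ "Pow (verts D6)"]) (auto simp: independent_def finite_verts_D6)
  show "card S \<le> 3" if "independent D6 S" for S
    using independent_D6_cases[OF that]
      card_mono[of "{v1, v3, v7}" S] card_mono[of "{v2, v4, v7}" S] card_mono[of "{v5, v6}" S]
    by auto
  show "independent D6 {v1, v3, v7}"
    using independent_colouring_D6 by blast
qed simp

lemma chromatic_number_D6: "chromatic_number D6 = 3"
  unfolding chromatic_number_def
proof (rule Min_card_eqI)
  show "finite {P. partition_on (verts D6) P \<and> (\<forall>S\<in>P. independent D6 S)}"
    by (rule finite_subset[of _ "Pow (Pow (verts D6))"])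
      (auto simp: independent_def finite_verts_D6)
  show "3 \<le> card P" if "partition_on (verts D6) P \<and> (\<forall>S\<in>P. independent D6 S)" for P
  proof -
    have "finite P"
      using that finite_elements finite_verts_D6 by blast
    moreover have "u \<rightarrow>\<^bsub>D6\<^esub> v \<or> v \<rightarrow>\<^bsub>D6\<^esub> u" if "u \<in> {v1, v2, v5}" "v \<in> {v1, v2, v5}" "u \<noteq> v" for u v
      using that by (cases u; cases v) (simp_all add: adj_D6 arcs_D6)
    moreover have "{v1, v2, v5} \<subseteq> verts D6"
      by (simp add: verts_D6)
    ultimately have "card {v1, v2, v5} \<le> card P"
      using that card_clique_le_independent_partition[of D6 P "{v1, v2, v5}"] by blast
    then show ?thesis by simp
  qed
  show "partition_on (verts D6) colouring_D6 \<and> (\<forall>S\<in>colouring_D6. independent D6 S)"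
    using partition_colouring_D6 independent_colouring_D6 by blast
qed (rule card_colouring_D6)

lemma domination_number_D6: "domination_number D6 = 2"
  unfolding domination_number_def
proof (rule Min_card_eqI)
  show "finite {S. dominating D6 S}"
    by (rule finite_subset[of _ "Pow (verts D6)"]) (auto simp: dominating_def finite_verts_D6)
  show "2 \<le> card S" if "dominating D6 S" for S
  proof -
    have S: "S \<subseteq> verts D6" "\<And>v. v \<in> verts D6 \<Longrightarrow> v \<in> S \<or> (\<exists>u\<in>S. (u, v) \<in> arcs D6)"
      using that by (auto simp: dominating_def adj_D6)
    have "v7 \<in> S"
      using S(2)[of v7] by (auto simp: verts_D6 arcs_D6)
    \<comment> \<open>Take \<open>v1\<close> itself if it lies in \<open>S\<close>, and otherwise an
      in-neighbour of it in \<open>S\<close>.\<close>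
    moreover obtain u where "u \<in> S" "u \<noteq> v7"
      using S(2)[of v1] by (auto simp: verts_D6 arcs_D6)
    ultimately show ?thesis
      using card_mono[of S "{u, v7}"] finite_subset[OF S(1) finite_verts_D6] by simp
  qed
  \<comment> \<open>Here \<open>v7\<close> takes care of \<open>v6\<close>, and \<open>v5\<close> of
    \<open>v1\<close> to \<open>v4\<close>.\<close>
  show "dominating D6 {v5, v7}"
    by (auto simp: dominating_def adj_D6 arcs_D6 verts_D6)
qed simp

section \<open>A directed spanning tree of \<open>D6\<close>\<close>

definition tree_D6 :: "(vertex, vertex \<times> vertex) pre_digraph" where
  "tree_D6 = D6\<lparr>arcs := {(v7,v5), (v7,v6), (v5,v1), (v5,v2), (v5,v3), (v5,v4)}\<rparr>"

lemma directed_spanning_tree_D6: "directed_spanning_tree tree_D6 D6 v7"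
proof -
  \<comment> \<open>The distance from the root \<open>v7\<close> in the tree.\<close>
  let ?depth = "\<lambda>v. if v = v7 then 0 else if v \<in> {v5, v6} then 1 else (2::nat)"
  interpret levelled_digraph tree_D6 ?depth
    by unfold_locales (auto simp: tree_D6_def D6_def inj_on_def)
  interpret D6: digraph D6 by (rule digraph_D6)
  have "spanning tree_D6 D6"
    unfolding spanning_def subgraph_def compatible_def
    using wf_digraph_axioms D6.wf_digraph_axioms by (auto simp: tree_D6_def D6_def)
  moreover have adj: "v7 \<rightarrow>\<^bsub>tree_D6\<^esub> v5" "v7 \<rightarrow>\<^bsub>tree_D6\<^esub> v6" "v5 \<rightarrow>\<^bsub>tree_D6\<^esub> v1"
    "v5 \<rightarrow>\<^bsub>tree_D6\<^esub> v2" "v5 \<rightarrow>\<^bsub>tree_D6\<^esub> v3" "v5 \<rightarrow>\<^bsub>tree_D6\<^esub> v4"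
    by (simp_all add: arcs_ends_def arc_to_ends_def tree_D6_def D6_def)
  moreover have "v7 \<in> verts tree_D6"
    by (simp add: tree_D6_def D6_def)
  moreover have "v7 \<rightarrow>\<^sup>*\<^bsub>tree_D6\<^esub> v" for v
    using adj \<open>v7 \<in> verts tree_D6\<close> by (cases v) (blast intro: reachable_adj_trans)+
  ultimately show ?thesis
    by (intro directed_spanning_tree_rooted) auto
qed

theorem theorem3p6:
  shows "partite 3 D6
    \<and> matching_number D6 = 3
    \<and> independence_number D6 = 3
    \<and> chromatic_number D6 = 3
    \<and> (\<exists>T r. directed_spanning_tree T D6 r)
    \<and> domination_number D6 = 2"
  using partite_D6 matching_number_D6 independence_number_D6 chromatic_number_D6
    directed_spanning_tree_D6 domination_number_D6 by blast

end
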